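(* Let $n\ge1$, let $A\in\mathbb{H}^{n\times n}$ and $B\in\mathbb{H}^n$ be such that $(A,B)$ is controllable, and let $(A_c,B_c)$ be its lower controllable companion form via $T$, so that $A_c=T^{-1}AT$, $B_c=T^{-1}B$. Write the last row of $A_c$ as $[-a_0,\dots,-a_{n-1}]$, and let $a(\lambda)=a_0+a_1\lambda+\cdots+a_{n-1}\lambda^{n-1}+\lambda^n$ be the companion polynomial. Let $$a_d(\lambda)=d_0+d_1\lambda+\cdots+d_{n-1}\lambda^{n-1}+\lambda^n\in\mathbb{H}[\lambda]$$ be any monic quaternionic polynomial. Then there exists a unique $K\in\mathbb{H}^{1\times n}$ (state feedback $u=-Kx$) such that, with $K_c:=KT$, the companion polynomial of $A_{\mathrm{cl},c}:=A_c-B_cK_c$ equals $a_d$. Consequently, the right spectrum of $A_{\mathrm{cl}}:=A-BK$ is the set of similarity classes determined by the right zeros of $a_d$: $$\sigma_r(A-BK)=\{[\lambda]:\lambda\in\mathbb{H},\ a_d(\lambda)_r=0\}.$$ Moreover, $$K=K_cT^{-1},\qquad K_c=[\,d_0-a_0,\ d_1-a_1,\ \dots,\ d_{n-1}-a_{n-1}\,].$$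
   Context: $\mathbb{H}$ denotes the real quaternions (noncommutative). Two quaternions $q,r$ are similar if $q=\alpha^{-1}r\alpha$ for some nonzero $\alpha\in\mathbb{H}$; $[q]$ denotes the similarity class of $q$. In $\mathbb{H}[\lambda]$ the indeterminate commutes with the coefficients. For $p(\lambda)=\sum_k p_k\lambda^k$ and $q\in\mathbb{H}$, the right evaluation is $p(q)_r=\sum_k p_kq^k$; a right zero of $p$ is $q$ with $p(q)_r=0$. For $M\in\mathbb{H}^{n\times n}$, the right spectrum is the set of similarity classes $\sigma_r(M)=\{[\lambda]:\exists\, v\in\mathbb{H}^n,\ v\neq0,\ Mv=v\lambda\}$. It is a set and does not record multiplicities (any multiplicities are encoded by the polynomial $a_d$ itself). $(A,B)$ is controllable if the controllability matrix $\mathcal{C}=[B,AB,\dots,A^{n-1}B]$ is invertible over $\mathbb{H}$. In that case there is a unique invertible $T\in\mathbb{H}^{n\times n}$ such that $A_c=T^{-1}AT$, $B_c=T^{-1}B$ is in lower controllable companion form, meaning $$A_c=\begin{bmatrix}0&1&\cdots&0\\ \vdots&\vdots&\ddots&\vdots\\ 0&0&\cdots&1\\ -a_0&-a_1&\cdots&-a_{n-1}\end{bmatrix},\qquad B_c=\begin{bmatrix}0\\ \vdots\\ 0\\ 1\end{bmatrix}$$ for some $a_0,\dots,a_{n-1}\in\mathbb{H}$ (explicitly, $T^{-1}$ has rows $t,tA,\dots,tA^{n-1}$, where $t$ is the last row of $\mathcal{C}^{-1}$). The companion polynomial of a matrix of this companion shape with last row $[-c_0,\dots,-c_{n-1}]$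 is $c_0+c_1\lambda+\cdots+c_{n-1}\lambda^{n-1}+\lambda^n$. Note that $A_c-B_cK_c$ is again of this companion shape for every $K_c\in\mathbb{H}^{1\times n}$. *)

theory Defs
  imports Complex_Main "HOL-Computational_Algebra.Polynomial" "Jordan_Normal_Form.Matrix"
begin

datatype quat = Quat (qRe: real) (qIm1: real) (qIm2: real) (qIm3: real)

lemma quat_eq_iff:
  "x = y \<longleftrightarrow> qRe x = qRe y \<and> qIm1 x = qIm1 y \<and> qIm2 x = qIm2 y \<and> qIm3 x = qIm3 y"
  by (cases x; cases y) auto

instantiation quat :: ab_group_add
begin

definition "0 = Quat 0 0 0 0"

definition "x + y = Quat (qRe x + qRe y) (qIm1 x + qIm1 y) (qIm2 x + qIm2 y) (qIm3 x + qIm3 y)"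

definition "- x = Quat (- qRe x) (- qIm1 x) (- qIm2 x) (- qIm3 x)"

definition "x - y = Quat (qRe x - qRe y) (qIm1 x - qIm1 y) (qIm2 x - qIm2 y) (qIm3 x - qIm3 y)"

instance
  by standard (auto simp: zero_quat_def plus_quat_def uminus_quat_def minus_quat_def)

end

text \<open>The multiplication is determined by \<open>i\<^sup>2 = j\<^sup>2 = k\<^sup>2 = ijk = -1\<close>, where
  \<open>Quat a b c d\<close> stands for \<open>a + bi + cj + dk\<close>; the inverse is the conjugate divided
  by the squared norm.\<close>

instantiation quat :: division_ring
begin

definition "1 = Quat 1 0 0 0"

definition "x * y = Quat
  (qRe x * qRe y - qIm1 x * qIm1 y - qIm2 x * qIm2 y - qIm3 x * qIm3 y)
  (qRe x * qIm1 y + qIm1 x * qRe y + qIm2 x * qIm3 y - qIm3 x * qIm2 y)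
  (qRe x * qIm2 y - qIm1 x * qIm3 y + qIm2 x * qRe y + qIm3 x * qIm1 y)
  (qRe x * qIm3 y + qIm1 x * qIm2 y - qIm2 x * qIm1 y + qIm3 x * qRe y)"

definition "inverse x =
  (let m = (qRe x)\<^sup>2 + (qIm1 x)\<^sup>2 + (qIm2 x)\<^sup>2 + (qIm3 x)\<^sup>2
   in Quat (qRe x / m) (- qIm1 x / m) (- qIm2 x / m) (- qIm3 x / m))"

definition "x div (y :: quat) = x * inverse y"

instance
proof
  fix x y z :: quat
  have norm_nz: "(qRe x)\<^sup>2 + (qIm1 x)\<^sup>2 + (qIm2 x)\<^sup>2 + (qIm3 x)\<^sup>2 \<noteq> 0" if "x \<noteq> 0"
  proof
    assume "(qRe x)\<^sup>2 + (qIm1 x)\<^sup>2 + (qIm2 x)\<^sup>2 + (qIm3 x)\<^sup>2 = 0"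
    then have "qRe x = 0 \<and> qIm1 x = 0 \<and> qIm2 x = 0 \<and> qIm3 x = 0"
      by (simp add: add_nonneg_eq_0_iff)
    with that show False by (simp add: quat_eq_iff zero_quat_def)
  qed
  show "x * y * z = x * (y * z)"
    by (simp add: times_quat_def algebra_simps)
  show "1 * x = x" "x * 1 = x"
    by (simp_all add: times_quat_def one_quat_def)
  show "(x + y) * z = x * z + y * z" "x * (y + z) = x * y + x * z"
    by (simp_all add: times_quat_def plus_quat_def algebra_simps)
  show "(0 :: quat) \<noteq> 1"
    by (simp add: zero_quat_def one_quat_def)
  show "inverse x * x = 1" "x * inverse x = 1" if "x \<noteq> 0"
    using norm_nz[OF that]
    by (simp_all add: inverse_quat_def Let_def times_quat_def one_quat_def
        add_divide_distrib[symmetric] diff_divide_distrib[symmetric] power2_eq_square algebra_simps)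
  show "x div y = x * inverse y"
    by (rule divide_quat_def)
  show "inverse (0 :: quat) = 0"
    by (simp add: inverse_quat_def zero_quat_def)
qed

end

definition quat_similar :: "quat \<Rightarrow> quat \<Rightarrow> bool" where
  "quat_similar q r \<longleftrightarrow> (\<exists>\<alpha>. \<alpha> \<noteq> 0 \<and> q = inverse \<alpha> * r * \<alpha>)"

definition similarity_class :: "quat \<Rightarrow> quat set" where
  "similarity_class q = {r. quat_similar r q}"

text \<open>The library's evaluation \<^const>\<open>poly\<close> requires commutative coefficients. The
  indeterminate of a \<open>quat poly\<close> commutes with the coefficients, and evaluation places the powers
  of the argument to the right of the coefficients.\<close>

definition right_eval :: "quat poly \<Rightarrow> quat \<Rightarrow> quat" where
  "right_eval p q = (\<Sum>k\<le>degree p. coeff p k * q ^ k)"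

definition right_zero :: "quat poly \<Rightarrow> quat \<Rightarrow> bool" where
  "right_zero p q \<longleftrightarrow> right_eval p q = 0"

text \<open>The library's \<open>\<cdot>\<^sub>v\<close> multiplies by scalars from the left.\<close>

definition right_smult_vec :: "quat vec \<Rightarrow> quat \<Rightarrow> quat vec" where
  "right_smult_vec v q = map_vec (\<lambda>x. x * q) v"

definition right_spectrum :: "quat mat \<Rightarrow> quat set set" where
  "right_spectrum M = {similarity_class q | q.
     \<exists>v \<in> carrier_vec (dim_row M). v \<noteq> 0\<^sub>v (dim_row M) \<and> M *\<^sub>v v = right_smult_vec v q}"

text \<open>Only meaningful when \<open>M\<close> satisfies \<^const>\<open>invertible_mat\<close>.\<close>

definition mat_inv :: "quat mat \<Rightarrow> quat mat" where
  "mat_inv M = (THE N. inverts_mat M N \<and> inverts_mat N M)"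

lemma mat_inv:
  assumes M: "M \<in> carrier_mat n n" and inv: "invertible_mat M"
  shows "mat_inv M \<in> carrier_mat n n" "M * mat_inv M = 1\<^sub>m n" "mat_inv M * M = 1\<^sub>m n"
proof -
  have carr: "N \<in> carrier_mat n n" if "inverts_mat M N" "inverts_mat N M" for N
  proof -
    have "M * N = 1\<^sub>m n" "N * M = 1\<^sub>m (dim_row N)"
      using that M by (auto simp: inverts_mat_def)
    then have "dim_col (M * N) = n" "dim_col (N * M) = dim_row N" by simp_all
    then show ?thesis using M by auto
  qed
  have uniq: "N = N'" if N: "inverts_mat M N" "inverts_mat N M"
    and N': "inverts_mat M N'" "inverts_mat N' M" for N N'
  proof -
    have c: "N \<in> carrier_mat n n" "N' \<in> carrier_mat n n"
      using carr N N' by auto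
    have "N = N * (M * N')"
      using N'(1) M c by (simp add: inverts_mat_def)
    also have "\<dots> = (N * M) * N'"
      using M c by simp
    also have "\<dots> = N'"
      using N(2) c by (simp add: inverts_mat_def)
    finally show ?thesis .
  qed
  obtain N where N: "inverts_mat M N" "inverts_mat N M"
    using inv by (auto simp: invertible_mat_def)
  have eq: "mat_inv M = N"
    unfolding mat_inv_def by (rule the_equality) (use N uniq in auto)
  show "mat_inv M \<in> carrier_mat n n" "M * mat_inv M = 1\<^sub>m n" "mat_inv M * M = 1\<^sub>m n"
    using eq N carr[OF N] M by (auto simp: inverts_mat_def)
qed

text \<open>Columns are \<open>n \<times> 1\<close> matrices and rows are \<open>1 \<times> n\<close> matrices; all indices start
  at \<open>0\<close>.\<close>

definition controllability_mat :: "nat \<Rightarrow> quat mat \<Rightarrow> quat mat \<Rightarrow> quat mat" where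
  "controllability_mat n A B = mat n n (\<lambda>(i, j). (A ^\<^sub>m j * B) $$ (i, 0))"

definition controllable :: "nat \<Rightarrow> quat mat \<Rightarrow> quat mat \<Rightarrow> bool" where
  "controllable n A B \<longleftrightarrow> invertible_mat (controllability_mat n A B)"

text \<open>The last row is unconstrained.\<close>

definition companion_shape :: "nat \<Rightarrow> quat mat \<Rightarrow> bool" where
  "companion_shape n M \<longleftrightarrow> M \<in> carrier_mat n n \<and>
     (\<forall>i j. i + 1 < n \<longrightarrow> j < n \<longrightarrow> M $$ (i, j) = (if j = i + 1 then 1 else 0))"

definition last_unit_col :: "nat \<Rightarrow> quat mat" where
  "last_unit_col n = mat n 1 (\<lambda>(i, j). if i + 1 = n then 1 else 0)"

definition lower_companion_via :: "nat \<Rightarrow> quat mat \<Rightarrow> quat mat \<Rightarrow> quat mat \<Rightarrow> bool" where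
  "lower_companion_via n A B T \<longleftrightarrow> T \<in> carrier_mat n n \<and> invertible_mat T \<and>
     companion_shape n (mat_inv T * A * T) \<and> mat_inv T * B = last_unit_col n"

text \<open>Meaningful for matrices of companion shape: a last row \<open>[-c\<^sub>0, \<dots>, -c\<^sub>n\<^sub>-\<^sub>1]\<close> gives the
  polynomial with coefficients \<open>c\<^sub>0, \<dots>, c\<^sub>n\<^sub>-\<^sub>1, 1\<close>.\<close>

definition companion_poly :: "nat \<Rightarrow> quat mat \<Rightarrow> quat poly" where
  "companion_poly n M = (\<Sum>j<n. monom (- (M $$ (n - 1, j))) j) + monom 1 n"

end

theory Submission
  imports Defs
begin

text \<open>In companion coordinates a feedback row only shifts the last row of \<open>A\<^sub>c\<close>, so the
  coefficients of the closed-loop companion polynomial can be prescribed one by one. If \<open>C\<close> is of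
  companion shape and \<open>C v = v q\<close>, then \<open>v\<^sub>i = v\<^sub>0 q\<^sup>i\<close>, and the last row says that the conjugate
  \<open>v\<^sub>0 q v\<^sub>0\<^sup>-\<^sup>1\<close> is a right zero of the companion polynomial; conversely a right zero \<open>q\<close> has the
  eigenvector \<open>(1, q, \<dots>, q\<^sup>n\<^sup>-\<^sup>1)\<close>.\<close>

section \<open>Similarity and conjugation of quaternions\<close>

lemma quat_similar_sym:
  assumes "quat_similar q r"
  shows "quat_similar r q"
proof -
  obtain \<alpha> where \<alpha>: "\<alpha> \<noteq> 0" "q = inverse \<alpha> * r * \<alpha>"
    using assms by (auto simp: quat_similar_def)
  have "inverse (inverse \<alpha>) * q * inverse \<alpha> = (\<alpha> * inverse \<alpha>) * r * (\<alpha> * inverse \<alpha>)"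
    using \<alpha> by (simp only: mult.assoc inverse_inverse_eq)
  also have "\<dots> = r" using \<alpha>(1) by simp
  finally show ?thesis
    unfolding quat_similar_def using \<alpha>(1) by (intro exI[of _ "inverse \<alpha>"]) simp
qed

lemma quat_similar_trans:
  assumes "quat_similar p q" "quat_similar q r"
  shows "quat_similar p r"
proof -
  obtain \<alpha> \<beta> where "\<alpha> \<noteq> 0" "p = inverse \<alpha> * q * \<alpha>" "\<beta> \<noteq> 0" "q = inverse \<beta> * r * \<beta>"
    using assms by (auto simp: quat_similar_def)
  then have "\<beta> * \<alpha> \<noteq> 0" "p = inverse (\<beta> * \<alpha>) * r * (\<beta> * \<alpha>)"
    by (simp_all add: nonzero_inverse_mult_distrib mult.assoc)
  then show ?thesis unfolding quat_similar_def by blast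
qed

lemma similarity_class_cong:
  assumes "quat_similar q r"
  shows "similarity_class q = similarity_class r"
  using assms unfolding similarity_class_def by (blast intro: quat_similar_sym quat_similar_trans)

text \<open>The inner factors \<open>inverse x * x\<close> telescope and the trailing
  \<open>x\<close> cancels the last inverse. It lets a left factor \<open>x\<close> move past powers
  of \<open>q\<close>, at the price of conjugating them.\<close>

lemma power_conjugate:
  fixes x q :: "'a :: division_ring"
  assumes "x \<noteq> 0"
  shows "(x * q * inverse x) ^ j * x = x * q ^ j"
proof (induction j)
  case (Suc j)
  have "(x * q * inverse x) ^ Suc j * x = (x * q * inverse x) * (x * q ^ j)"
    by (simp only: power_Suc mult.assoc[of "x * q * inverse x"] Suc)
  also have "\<dots> = x * q * (inverse x * x) * q ^ j" by (simp only: mult.assoc)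
  also have "\<dots> = x * q ^ Suc j" using assms by (simp add: mult.assoc)
  finally show ?case .
qed simp

section \<open>Coefficients and right evaluation of the companion polynomial\<close>

lemma coeff_companion_poly:
  "coeff (companion_poly n M) j = (if j < n then - (M $$ (n - 1, j)) else if j = n then 1 else 0)"
  by (simp add: companion_poly_def coeff_sum)

text \<open>Both polynomials are monic of degree \<open>n\<close>, so only the coefficients below
  \<open>n\<close> can differ, and those of \<open>companion_poly n M\<close> are the negated last
  row.\<close>

lemma companion_poly_eq_iff:
  assumes "degree p = n" "lead_coeff p = 1"
  shows "companion_poly n M = p \<longleftrightarrow> (\<forall>j<n. M $$ (n - 1, j) = - coeff p j)"
proof -
  have high: "coeff (companion_poly n M) j = coeff p j" if "\<not> j < n" for j
    using that assms by (cases "j = n") (auto simp: coeff_companion_poly coeff_eq_0)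
  have "companion_poly n M = p \<longleftrightarrow> (\<forall>j<n. coeff (companion_poly n M) j = coeff p j)"
    unfolding poly_eq_iff using high by blast
  also have "\<dots> \<longleftrightarrow> (\<forall>j<n. M $$ (n - 1, j) = - coeff p j)"
  proof -
    have "- x = y \<longleftrightarrow> x = - y" for x y :: quat by auto
    then show ?thesis by (simp add: coeff_companion_poly)
  qed
  finally show ?thesis .
qed

lemma right_eval_companion_poly:
  "right_eval (companion_poly n M) q = q ^ n - (\<Sum>j<n. M $$ (n - 1, j) * q ^ j)"
proof -
  have "degree (companion_poly n M) \<le> n"
    by (rule degree_le) (simp add: coeff_companion_poly)
  moreover have "coeff (companion_poly n M) n \<noteq> 0" by (simp add: coeff_companion_poly)
  ultimately have "degree (companion_poly n M) = n" by (simp add: le_antisym le_degree)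
  then show ?thesis
    by (simp add: right_eval_def coeff_companion_poly lessThan_Suc_atMost[symmetric] sum_negf)
qed

section \<open>Right eigenvectors of companion matrices\<close>

lemma mult_mat_right_smult_vec:
  assumes "M \<in> carrier_mat m n" "v \<in> carrier_vec n"
  shows "M *\<^sub>v right_smult_vec v q = right_smult_vec (M *\<^sub>v v) q"
proof (rule eq_vecI)
  fix i assume "i < dim_vec (right_smult_vec (M *\<^sub>v v) q)"
  then have "i < m" using assms by (simp add: right_smult_vec_def)
  then show "(M *\<^sub>v right_smult_vec v q) $ i = right_smult_vec (M *\<^sub>v v) q $ i"
    using assms by (simp add: right_smult_vec_def scalar_prod_def sum_distrib_right mult.assoc)
qed (simp add: right_smult_vec_def)

text \<open>Every row but the last shifts the vector, which gives the recurrence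
  \<open>v $ Suc i = v $ i * q\<close> and hence a geometric sequence determined by
  \<open>v $ 0\<close>. The last row remains as the only genuine condition on
  \<open>q\<close>.\<close>

lemma companion_shape_eigenvector_iff:
  assumes C: "companion_shape n C" and n: "n \<ge> 1" and v: "v \<in> carrier_vec n"
  shows "C *\<^sub>v v = right_smult_vec v q \<longleftrightarrow>
    (\<forall>i<n. v $ i = v $ 0 * q ^ i) \<and> (\<Sum>j<n. C $$ (n - 1, j) * v $ j) = v $ (n - 1) * q"
proof -
  have Cc: "C \<in> carrier_mat n n" using C by (simp add: companion_shape_def)
  have last: "(C *\<^sub>v v) $ (n - 1) = (\<Sum>j<n. C $$ (n - 1, j) * v $ j)"
    using Cc v n by (auto simp: scalar_prod_def lessThan_atLeast0 intro!: sum.cong)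
  have shift: "(C *\<^sub>v v) $ i = v $ Suc i" if "Suc i < n" for i
  proof -
    have "(C *\<^sub>v v) $ i = (\<Sum>j<n. C $$ (i, j) * v $ j)"
      using Cc v that by (auto simp: scalar_prod_def lessThan_atLeast0 intro!: sum.cong)
    also have "\<dots> = (\<Sum>j<n. if j = Suc i then v $ j else 0)"
      using C that by (intro sum.cong) (auto simp: companion_shape_def)
    also have "\<dots> = v $ Suc i" using that by simp
    finally show ?thesis .
  qed
  have "C *\<^sub>v v = right_smult_vec v q \<longleftrightarrow> (\<forall>i<n. (C *\<^sub>v v) $ i = v $ i * q)"
    using Cc v by (auto simp: vec_eq_iff right_smult_vec_def)
  also have "\<dots> \<longleftrightarrow> (\<forall>i. Suc i < n \<longrightarrow> v $ Suc i = v $ i * q) \<and>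
      (\<Sum>j<n. C $$ (n - 1, j) * v $ j) = v $ (n - 1) * q" (is "?L \<longleftrightarrow> ?R")
  proof
    assume L: ?L
    have "v $ Suc i = v $ i * q" if "Suc i < n" for i
      using L shift[OF that] that by simp
    then show ?R using L[rule_format, of "n - 1"] last n by simp
  next
    assume R: ?R
    show ?L
    proof (intro allI impI)
      fix i assume i: "i < n"
      show "(C *\<^sub>v v) $ i = v $ i * q"
      proof (cases "Suc i < n")
        case False
        then have "i = n - 1" using i by simp
        then show ?thesis using R last by simp
      qed (use R shift in simp)
    qed
  qed
  also have "(\<forall>i. Suc i < n \<longrightarrow> v $ Suc i = v $ i * q) \<longleftrightarrow> (\<forall>i<n. v $ i = v $ 0 * q ^ i)"
    (is "?L \<longleftrightarrow> ?R")
  proof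
    assume L: ?L
    have "v $ i = v $ 0 * q ^ i" if "i < n" for i
      using that
    proof (induction i)
      case (Suc i)
      \<comment> \<open>The recurrence appends \<open>q\<close> on the right, whereas
        \<open>power_Suc\<close> puts the new factor on the left; powers of the same
        \<open>q\<close> commute with it.\<close>
      then show ?case using L by (simp add: power_commutes mult.assoc)
    qed simp
    then show ?R by blast
  next
    assume R: ?R
    have "v $ Suc i = v $ i * q" if "Suc i < n" for i
      using R[rule_format, of "Suc i"] R[rule_format, of i] that
      by (simp add: power_commutes mult.assoc)
    then show ?L by blast
  qed
  finally show ?thesis .
qed

text \<open>An eigenvalue \<open>q\<close> need not be a right zero itself: the entry
  \<open>v $ 0\<close> stands between the matrix coefficients and the powers of \<open>q\<close>.
  Only a conjugate of \<open>q\<close> is shown to be a zero, which suffices because the spectrum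
  consists of classes.\<close>

lemma right_spectrum_companion_shape:
  assumes C: "companion_shape n C" and n: "n \<ge> 1"
  shows "right_spectrum C = {similarity_class q | q. right_zero (companion_poly n C) q}"
proof (intro equalityI subsetI)
  have dim: "dim_row C = n" using C by (auto simp: companion_shape_def)
  \<comment> \<open>The last entry carries the exponent \<open>n - 1\<close>; since
    \<open>n \<ge> 1\<close>, the eigenvalue factor raises it to the leading exponent
    \<open>n\<close>.\<close>
  have pow: "q ^ (n - Suc 0) * q = q ^ n" for q :: quat
    using n power_minus_mult[of n q] by simp
  fix s
  {
    assume "s \<in> right_spectrum C"
    then obtain q v where s: "s = similarity_class q" and v: "v \<in> carrier_vec n" "v \<noteq> 0\<^sub>v n"
      and eig: "C *\<^sub>v v = right_smult_vec v q"
      unfolding right_spectrum_def dim by blast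
    define x where "x = v $ 0"
    \<comment> \<open>This side of the conjugation gives \<open>r ^ j * x = x * q ^ j\<close>, so
      that \<open>x\<close> can be pulled out to the right of all coefficients.\<close>
    define r where "r = x * q * inverse x"
    have vi: "v $ i = x * q ^ i" if "i < n" for i
      using eig companion_shape_eigenvector_iff[OF C n v(1)] that unfolding x_def by blast
    have last: "(\<Sum>j<n. C $$ (n - 1, j) * v $ j) = v $ (n - 1) * q"
      using eig companion_shape_eigenvector_iff[OF C n v(1)] by blast
    have x: "x \<noteq> 0"
    proof
      assume "x = 0"
      then have "v = 0\<^sub>v n" using v(1) vi by (intro eq_vecI) auto
      with v(2) show False by simp
    qed
    have rj: "r ^ j * x = x * q ^ j" for j
      unfolding r_def by (rule power_conjugate[OF x])
    \<comment> \<open>Multiplied by \<open>x\<close> on the right, the evaluation at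
      \<open>r\<close> becomes the last row applied to \<open>v\<close>; the nonzero
      \<open>x\<close> is cancelled at the end.\<close>
    have "(\<Sum>j<n. C $$ (n - 1, j) * r ^ j) * x = (\<Sum>j<n. C $$ (n - 1, j) * v $ j)"
      by (simp add: sum_distrib_right mult.assoc rj vi)
    also note last
    also have "v $ (n - 1) * q = r ^ n * x"
      using n by (simp add: vi mult.assoc pow rj)
    finally have "(right_eval (companion_poly n C) r) * x = 0"
      by (simp only: right_eval_companion_poly left_diff_distrib diff_self)
    then have "right_zero (companion_poly n C) r" using x by (simp add: right_zero_def)
    moreover have "quat_similar r q"
      unfolding quat_similar_def r_def using x by (intro exI[of _ "inverse x"]) simp
    ultimately show "s \<in> {similarity_class q | q. right_zero (companion_poly n C) q}"
      using s similarity_class_cong by blast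
  next
    assume "s \<in> {similarity_class q | q. right_zero (companion_poly n C) q}"
    then obtain q where s: "s = similarity_class q" and z: "right_zero (companion_poly n C) q"
      by blast
    define v where "v = vec n (\<lambda>i. q ^ i)"
    have v: "v \<in> carrier_vec n" by (simp add: v_def)
    have "v $ 0 = 1" using n by (simp add: v_def)
    then have v0: "v \<noteq> 0\<^sub>v n" using n by auto
    have "C *\<^sub>v v = right_smult_vec v q"
      using z n unfolding companion_shape_eigenvector_iff[OF C n v]
      by (simp add: v_def pow right_zero_def right_eval_companion_poly)
    then show "s \<in> right_spectrum C"
      unfolding right_spectrum_def dim using s v v0 by blast
  }
qed

section \<open>Invariance of the right spectrum under change of basis\<close>

lemma right_spectrum_subset_similar:
  assumes M: "M \<in> carrier_mat n n" and S: "S \<in> carrier_mat n n" and T: "T \<in> carrier_mat n n"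
    and TS: "T * S = 1\<^sub>m n"
  shows "right_spectrum M \<subseteq> right_spectrum (S * M * T)"
proof
  fix s assume "s \<in> right_spectrum M"
  then obtain q v where s: "s = similarity_class q" and v: "v \<in> carrier_vec n" "v \<noteq> 0\<^sub>v n"
    and eig: "M *\<^sub>v v = right_smult_vec v q"
    unfolding right_spectrum_def carrier_matD(1)[OF M] by blast
  have dim: "dim_row (S * M * T) = n" using S by simp
  have TSv: "T *\<^sub>v (S *\<^sub>v v) = v"
    using assoc_mult_mat_vec[OF T S v(1)] TS v by simp
  \<comment> \<open>The transported eigenvector is \<open>S *\<^sub>v v\<close>, with the same
    \<open>q\<close>: matrices act on the left and \<open>q\<close> on the right, so the two actions
    commute. The left inverse \<open>T\<close> keeps it nonzero.\<close>
  have Sv: "S *\<^sub>v v \<in> carrier_vec n" using S v by simp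
  have "S *\<^sub>v v \<noteq> 0\<^sub>v n"
  proof
    assume "S *\<^sub>v v = 0\<^sub>v n"
    then have "v = T *\<^sub>v 0\<^sub>v n" using TSv by simp
    also have "\<dots> = 0\<^sub>v n" using T by (intro eq_vecI) auto
    finally show False using v(2) by simp
  qed
  moreover have "(S * M * T) *\<^sub>v (S *\<^sub>v v) = right_smult_vec (S *\<^sub>v v) q"
  proof -
    have "(S * M * T) *\<^sub>v (S *\<^sub>v v) = S *\<^sub>v (M *\<^sub>v (T *\<^sub>v (S *\<^sub>v v)))"
      using S M T Sv by (simp add: assoc_mult_mat_vec[of _ n n _ n])
    also have "\<dots> = right_smult_vec (S *\<^sub>v v) q"
      using TSv eig mult_mat_right_smult_vec[OF S v(1)] by simp
    finally show ?thesis .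
  qed
  ultimately show "s \<in> right_spectrum (S * M * T)"
    unfolding right_spectrum_def dim using s Sv by blast
qed

lemma right_spectrum_similar:
  assumes M: "M \<in> carrier_mat n n" and S: "S \<in> carrier_mat n n" and T: "T \<in> carrier_mat n n"
    and TS: "T * S = 1\<^sub>m n" and ST: "S * T = 1\<^sub>m n"
  shows "right_spectrum (S * M * T) = right_spectrum M"
proof
  \<comment> \<open>The reverse inclusion is the same one with \<open>S\<close> and \<open>T\<close>
    exchanged, applied to the conjugated matrix.\<close>
  have "T * (S * M * T) * S = (T * S) * M * (T * S)"
    using M S T by (simp add: assoc_mult_mat[of _ n n _ n _ n])
  then have "T * (S * M * T) * S = M" using M TS by simp
  then show "right_spectrum (S * M * T) \<subseteq> right_spectrum M"
    using right_spectrum_subset_similar[of "S * M * T" n T S] M S T ST by simp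
qed (rule right_spectrum_subset_similar[OF M S T TS])

section \<open>Feedback in companion coordinates\<close>

lemma last_unit_col_carrier [simp]: "last_unit_col n \<in> carrier_mat n 1"
  by (simp add: last_unit_col_def)

lemma dim_last_unit_col [simp]: "dim_row (last_unit_col n) = n" "dim_col (last_unit_col n) = 1"
  by (simp_all add: last_unit_col_def)

lemma index_last_unit_col_mult:
  assumes "L \<in> carrier_mat 1 n" "i < n" "j < n"
  shows "(last_unit_col n * L) $$ (i, j) = (if i + 1 = n then L $$ (0, j) else 0)"
  using assms by (simp add: last_unit_col_def scalar_prod_def)

lemma index_feedback:
  assumes "L \<in> carrier_mat 1 n" "i < n" "j < n"
  shows "(M - last_unit_col n * L) $$ (i, j) = M $$ (i, j) - (if i + 1 = n then L $$ (0, j) else 0)"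
  \<comment> \<open>A matrix difference takes its dimensions from the subtrahend, so the bounds are
    checked against the product.\<close>
  using assms index_last_unit_col_mult[OF assms] by (subst index_minus_mat(1)) auto

lemma companion_shape_feedback:
  assumes "companion_shape n M" "L \<in> carrier_mat 1 n"
  shows "companion_shape n (M - last_unit_col n * L)"
proof -
  have P: "last_unit_col n * L \<in> carrier_mat n n"
    using assms(2) by (rule mult_carrier_mat[OF last_unit_col_carrier])
  have "M - last_unit_col n * L \<in> carrier_mat n n" using P by (rule minus_carrier_mat)
  then show ?thesis
    \<comment> \<open>Rows above the last are unchanged. Removing \<open>index_minus_mat\<close>
      leaves the entries of the difference to \<open>index_feedback\<close>.\<close>
    using assms by (auto simp: companion_shape_def index_feedback simp del: index_minus_mat)
qed

text \<open>Each feedback entry is added to exactly one coefficient, so the \<open>n\<close>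
  coefficient equations are independent and each has a single solution. The equivalence yields
  existence, uniqueness and the gain formula together.\<close>

lemma companion_poly_feedback_eq_iff:
  assumes M: "companion_shape n M" and L: "L \<in> carrier_mat 1 n" and n: "n \<ge> 1"
    and p: "degree p = n" "lead_coeff p = 1"
  shows "companion_poly n (M - last_unit_col n * L) = p \<longleftrightarrow>
    L = mat 1 n (\<lambda>(i, j). coeff p j - coeff (companion_poly n M) j)"
proof -
  have entry: "(M - last_unit_col n * L) $$ (n - 1, j) = M $$ (n - 1, j) - L $$ (0, j)"
    if "j < n" for j
    using that n index_feedback[OF L, of "n - 1" j] by simp
  have sign: "x - y = - z \<longleftrightarrow> y = z + x" for x y z :: quat
    by (auto simp: algebra_simps)
  have "companion_poly n (M - last_unit_col n * L) = p \<longleftrightarrow>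
      (\<forall>j<n. L $$ (0, j) = coeff p j + M $$ (n - 1, j))"
    unfolding companion_poly_eq_iff[OF p] by (simp only: entry sign cong: imp_cong)
  also have "\<dots> \<longleftrightarrow> L = mat 1 n (\<lambda>(i, j). coeff p j - coeff (companion_poly n M) j)"
    using L by (auto simp: mat_eq_iff coeff_companion_poly)
  finally show ?thesis .
qed

section \<open>Transfer between original and companion coordinates\<close>

lemma mult_mat_eq_iff_inverse:
  fixes S T :: "'a :: semiring_1 mat"
  assumes K: "K \<in> carrier_mat m n" and L: "L \<in> carrier_mat m n"
    and S: "S \<in> carrier_mat n n" and T: "T \<in> carrier_mat n n"
    and TS: "T * S = 1\<^sub>m n" and ST: "S * T = 1\<^sub>m n"
  shows "K * T = L \<longleftrightarrow> K = L * S"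
proof
  assume "K * T = L"
  then show "K = L * S" using assoc_mult_mat[OF K T S] TS K by simp
next
  assume "K = L * S"
  then show "K * T = L" using assoc_mult_mat[OF L S T] ST L by simp
qed

text \<open>With \<open>S\<close> the inverse of \<open>T\<close>, this identifies the closed loop
  \<open>A - B * K\<close>, seen in companion coordinates, with the feedback \<open>K * T\<close>
  applied to the companion pair.\<close>

lemma conjugate_feedback:
  fixes A B K S T :: "'a :: ring_1 mat"
  assumes "A \<in> carrier_mat n n" "B \<in> carrier_mat n m" "K \<in> carrier_mat m n"
    "S \<in> carrier_mat n n" "T \<in> carrier_mat n n"
  shows "S * (A - B * K) * T = S * A * T - S * B * (K * T)"
proof -
  have "S * (A - B * K) * T = S * A * T - S * (B * K) * T"
    using assms by (simp add: mult_minus_distrib_mat[of _ n n] minus_mult_distrib_mat[of _ n n])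
  also have "S * (B * K) * T = S * B * (K * T)"
    using assms by (simp add: assoc_mult_mat[of _ n n _ m _ n] assoc_mult_mat[of _ n m _ n _ n]
        assoc_mult_mat[of _ n n _ n _ n])
  finally show ?thesis .
qed

theorem theorem5:
  fixes n :: nat and A B T A\<^sub>c B\<^sub>c :: "quat mat" and a a\<^sub>d :: "quat poly"
  assumes "n \<ge> 1"
    and "A \<in> carrier_mat n n" and "B \<in> carrier_mat n 1"
    and "controllable n A B"
    and "lower_companion_via n A B T"
    and "A\<^sub>c = mat_inv T * A * T" and "B\<^sub>c = mat_inv T * B"
    and "a = companion_poly n A\<^sub>c"
    and "degree a\<^sub>d = n" and "lead_coeff a\<^sub>d = 1"
  shows "(\<exists>!K. K \<in> carrier_mat 1 n \<and> companion_poly n (A\<^sub>c - B\<^sub>c * (K * T)) = a\<^sub>d) \<and>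
    (\<forall>K \<in> carrier_mat 1 n. companion_poly n (A\<^sub>c - B\<^sub>c * (K * T)) = a\<^sub>d \<longrightarrow>
       companion_shape n (A\<^sub>c - B\<^sub>c * (K * T)) \<and>
       right_spectrum (A - B * K) = {similarity_class q | q. right_zero a\<^sub>d q} \<and>
       (let K\<^sub>c = mat 1 n (\<lambda>(i, j). coeff a\<^sub>d j - coeff a j)
        in K * T = K\<^sub>c \<and> K = K\<^sub>c * mat_inv T))"
proof -
  have T: "T \<in> carrier_mat n n" and invT: "invertible_mat T"
    and shape: "companion_shape n A\<^sub>c" and B\<^sub>c: "B\<^sub>c = last_unit_col n"
    using assms(5-7) by (simp_all add: lower_companion_via_def)
  note S = mat_inv[OF T invT]
  define K\<^sub>c where "K\<^sub>c = mat 1 n (\<lambda>(i, j). coeff a\<^sub>d j - coeff a j)"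
  have K\<^sub>c: "K\<^sub>c \<in> carrier_mat 1 n" by (simp add: K\<^sub>c_def)
  have gain: "K * T = K\<^sub>c \<longleftrightarrow> K = K\<^sub>c * mat_inv T" if "K \<in> carrier_mat 1 n" for K
    by (rule mult_mat_eq_iff_inverse[OF that K\<^sub>c S(1) T S(2,3)])
  have placed: "companion_poly n (A\<^sub>c - B\<^sub>c * (K * T)) = a\<^sub>d \<longleftrightarrow> K * T = K\<^sub>c"
    if "K \<in> carrier_mat 1 n" for K
    unfolding B\<^sub>c K\<^sub>c_def assms(8)
    by (rule companion_poly_feedback_eq_iff[OF shape _ assms(1,9,10)]) (use that T in simp)
  have closed_shape: "companion_shape n (A\<^sub>c - B\<^sub>c * (K * T))" if "K \<in> carrier_mat 1 n" for K
    unfolding B\<^sub>c by (rule companion_shape_feedback[OF shape]) (use that T in simp)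
  have spectrum: "right_spectrum (A - B * K) = {similarity_class q | q. right_zero a\<^sub>d q}"
    if K: "K \<in> carrier_mat 1 n" and p: "companion_poly n (A\<^sub>c - B\<^sub>c * (K * T)) = a\<^sub>d" for K
  proof -
    have "A - B * K \<in> carrier_mat n n" using mult_carrier_mat[OF assms(3) K] by (rule minus_carrier_mat)
    \<comment> \<open>The spectrum is moved to companion coordinates, where the prescribed
      polynomial determines it.\<close>
    then have "right_spectrum (A - B * K) = right_spectrum (mat_inv T * (A - B * K) * T)"
      using right_spectrum_similar S T by metis
    also have "mat_inv T * (A - B * K) * T = A\<^sub>c - B\<^sub>c * (K * T)"
      unfolding assms(6,7) by (rule conjugate_feedback[OF assms(2,3) K S(1) T])
    finally show ?thesis
      using right_spectrum_companion_shape[OF closed_shape[OF K] assms(1)] p by simp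
  qed
  have "K\<^sub>c * mat_inv T \<in> carrier_mat 1 n" using K\<^sub>c S(1) by simp
  then have "\<exists>!K. K \<in> carrier_mat 1 n \<and> companion_poly n (A\<^sub>c - B\<^sub>c * (K * T)) = a\<^sub>d"
    \<comment> \<open>By \<open>placed\<close> and \<open>gain\<close>, a row \<open>K\<close>
      places the polynomial iff it equals this witness, which settles both existence and
      uniqueness.\<close>
    using placed gain by (intro ex1I[of _ "K\<^sub>c * mat_inv T"]) blast+
  then show ?thesis
    unfolding Let_def K\<^sub>c_def[symmetric]
  proof (intro conjI ballI impI)
    fix K assume K: "K \<in> carrier_mat 1 n"
      and p: "companion_poly n (A\<^sub>c - B\<^sub>c * (K * T)) = a\<^sub>d"
    show "companion_shape n (A\<^sub>c - B\<^sub>c * (K * T))" by (rule closed_shape[OF K])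
    show "right_spectrum (A - B * K) = {similarity_class q | q. right_zero a\<^sub>d q}"
      by (rule spectrum[OF K p])
    show "K * T = K\<^sub>c" using p placed[OF K] by simp
    then show "K = K\<^sub>c * mat_inv T" using gain[OF K] by simp
  qed
qed

end
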